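(* For every $n\ge 3$, the Hilbert series of $\mathcal B_{\mathcal P_n}$ is $$\mathrm{Hilb}\,\mathcal B_{\mathcal P_n}(x)=1+\sum_{i=1}^{\lfloor\frac12(n-1)\rfloor+1}\ \sum\binom{n}{d_1,d_2,\dots,d_{i+1}}\frac{2d_{i+1}-n}{n}\,x^i,$$ where the inner sum is over all integer tuples $(d_1,\dots,d_{i+1})$ with $\sum_{k=1}^{i+1}d_k=n$, $d_1\ge0$, $d_k\ge1$ for all $2\le k\le i$, and $d_{i+1}\ge n-\lfloor\frac{n-1}{2}\rfloor$.
   Context: $[n]=\{1,\dots,n\}$; $\mathfrak S_n$ is the set of permutations of $[n]$ in one-line notation. The circular peak set of $\sigma\in\mathfrak S_n$ is $CP(\sigma)=\{\sigma(i)\mid 2\le i\le n-1,\ \sigma(i-1)<\sigma(i)>\sigma(i+1)\}$; for $S\subseteq[n]$, $CP_n(S)=\{\sigma\in\mathfrak S_n\mid CP(\sigma)=S\}$, and $\mathcal P_n=\{S\subseteq[n]\mid CP_n(S)\neq\emptyset\}$, ordered by inclusion. Fix a field $\mathbb K$, let $m=|\mathcal P_n|$ and enumerate $\mathcal P_n=\{S_{n,1},\dots,S_{n,m}\}$. $\mathcal J_{\mathcal P_n}\subseteq\mathbb K[x_1,\dots,x_m]$ is the ideal generated by all $x_ix_j$ such that $S_{n,i}$ and $S_{n,j}$ are incomparable under inclusion, together with all $x_i^2$ ($i\in[m]$), and $\mathcal B_{\mathcal P_n}=\mathbb K[x_1,\dots,x_m]/\mathcal J_{\mathcal P_n}$,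 graded by degree. The Hilbert series of a graded algebra $\mathcal B=\bigoplus_{k\ge0}\mathcal B^k$ is $\sum_{k\ge0}(\dim\mathcal B^k)x^k$. $\binom{n}{d_1,\dots,d_{i+1}}$ is the multinomial coefficient. *)

theory Defs
  imports
    "HOL-Algebra.QuotRing"
    "HOL-Algebra.Embedded_Algebras"
    "HOL-Combinatorics.Permutations"
    "HOL-Library.FuncSet"
    "HOL-Library.Poly_Mapping"
    "HOL-Computational_Algebra.Formal_Power_Series"
begin

(* Permutations of [n] are functions permuting {1..n}; sigma i is the i-th letter of the
   one-line notation.  The guard 2 <= i <= n - 1 keeps the comparison away from the ends
   (there is no wrap-around). *)
definition circular_peaks :: "nat \<Rightarrow> (nat \<Rightarrow> nat) \<Rightarrow> nat set" where
  "circular_peaks n \<sigma> =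
     {\<sigma> i | i. 2 \<le> i \<and> i \<le> n - 1 \<and> \<sigma> (i - 1) < \<sigma> i \<and> \<sigma> i > \<sigma> (i + 1)}"

definition CP_perms :: "nat \<Rightarrow> nat set \<Rightarrow> (nat \<Rightarrow> nat) set" where
  "CP_perms n S = {\<sigma>. \<sigma> permutes {1..n} \<and> circular_peaks n \<sigma> = S}"

definition CP_poset :: "nat \<Rightarrow> nat set set" where
  "CP_poset n = {S. S \<subseteq> {1..n} \<and> CP_perms n S \<noteq> {}}"

(* Polynomials in x_1, x_2, ... are finitely supported functions from exponent vectors to
   coefficients; Poly_Mapping supplies the convolution product. *)
type_synonym 'k mpoly = "(nat \<Rightarrow>\<^sub>0 nat) \<Rightarrow>\<^sub>0 'k"

definition mvar :: "nat \<Rightarrow> 'k::field mpoly" where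
  "mvar i = Poly_Mapping.single (Poly_Mapping.single i 1) 1"

definition mconst :: "'k \<Rightarrow> 'k::field mpoly" where
  "mconst c = Poly_Mapping.single 0 c"

definition mpoly_ring :: "nat \<Rightarrow> 'k::field mpoly ring" where
  "mpoly_ring m =
     \<lparr>carrier = {p. \<forall>t \<in> Poly_Mapping.keys p. Poly_Mapping.keys t \<subseteq> {1..m}},
      monoid.mult = (*), one = 1, zero = 0, add = (+)\<rparr>"

definition homogeneous :: "nat \<Rightarrow> 'k::field mpoly \<Rightarrow> bool" where
  "homogeneous k p \<longleftrightarrow>
     (\<forall>t \<in> Poly_Mapping.keys p. (\<Sum>i \<in> Poly_Mapping.keys t. Poly_Mapping.lookup t i) = k)"

(* In the next four definitions the family S 1, ..., S m enumerates the poset. *)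
definition poset_ideal :: "nat \<Rightarrow> (nat \<Rightarrow> nat set) \<Rightarrow> 'k::field mpoly set" where
  "poset_ideal m S = genideal (mpoly_ring m)
     ({mvar i * mvar j | i j. i \<in> {1..m} \<and> j \<in> {1..m} \<and> \<not> S i \<subseteq> S j \<and> \<not> S j \<subseteq> S i}
      \<union> {(mvar i)\<^sup>2 | i. i \<in> {1..m}})"

definition poset_algebra :: "nat \<Rightarrow> (nat \<Rightarrow> nat set) \<Rightarrow> 'k::field mpoly set ring" where
  "poset_algebra m S = mpoly_ring m Quot poset_ideal m S"

(* The copy of the ground field inside the quotient. *)
definition poset_algebra_scalars :: "nat \<Rightarrow> (nat \<Rightarrow> nat set) \<Rightarrow> 'k::field mpoly set set" where
  "poset_algebra_scalars m S =
     (\<lambda>c. poset_ideal m S +>\<^bsub>mpoly_ring m\<^esub> mconst c) ` UNIV"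

definition poset_algebra_piece ::
    "nat \<Rightarrow> (nat \<Rightarrow> nat set) \<Rightarrow> nat \<Rightarrow> 'k::field mpoly set set" where
  "poset_algebra_piece m S k =
     (\<lambda>p. poset_ideal m S +>\<^bsub>mpoly_ring m\<^esub> p) `
       {p \<in> carrier (mpoly_ring m). homogeneous k p}"

(* For a ring B containing a field K and graded by the K-subspaces G 0, G 1, ...
   The dimensions are cast to rat, where the coefficients of the closed formula live. *)
definition hilbert_series :: "('a, 'b) ring_scheme \<Rightarrow> 'a set \<Rightarrow> (nat \<Rightarrow> 'a set) \<Rightarrow> rat fps" where
  "hilbert_series B K G = Abs_fps (\<lambda>k. of_nat ((ring.dim B over K) (G k)))"

(* The division is exact whenever the d k, k in I, sum to n. *)
definition multinomial :: "nat \<Rightarrow> nat set \<Rightarrow> (nat \<Rightarrow> nat) \<Rightarrow> nat" where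
  "multinomial n I d = fact n div (\<Prod>k \<in> I. fact (d k))"

(* Tuples (d_1, ..., d_{i+1}), extensional outside {1..i+1}.  The constraints force all
   entries to be nonnegative, so nat loses no integer tuples; d_1 >= 0 is automatic. *)
definition hilbert_tuples :: "nat \<Rightarrow> nat \<Rightarrow> (nat \<Rightarrow> nat) set" where
  "hilbert_tuples n i =
     {d \<in> {1..i+1} \<rightarrow>\<^sub>E (UNIV :: nat set).
        (\<Sum>k = 1..i+1. d k) = n \<and>
        (\<forall>k. 2 \<le> k \<and> k \<le> i \<longrightarrow> d k \<ge> 1) \<and>
        d (i + 1) \<ge> n - (n - 1) div 2}"

end

(* A set A is a circular peak set of a permutation of [n] iff 2 |A \<inter> [x]| < x for every x in A:
   each of the |A \<inter> [x]| peaks with value at most x is preceded by a smaller non-peak, and the last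
   of them is also followed by one; conversely, interleave the elements of A in increasing order with
   the smallest elements of the complement.  Such sets correspond to strictly positive ballot
   sequences, so (n - 2s)/n * binom(n, s) of them have size s, and they are closed under taking subsets.

   The ideal is spanned by monomials, so the degree k piece of the quotient has the chains of k poset
   elements as a basis.  A chain A_1 < ... < A_k with |A_k| = s is an ordered set partition of A_k with
   block sizes d_1 = |A_1| \<ge> 0 and d_j = |A_j - A_(j-1)| \<ge> 1; multiplying the multinomial count
   of these by the number of ballot sets of size s = n - d_(k+1) gives the stated coefficient. *)
theory Submission
  imports Defs
begin

section \<open>Circular peak sets and ballot sets\<close>

text \<open>Read 1, ..., n as a walk that steps down at elements of \<open>A\<close> and up
  elsewhere. The condition keeps the height x - 2 |A \<inter> [x]| positive; testing it at the down
  steps suffices, since an up step cannot destroy positivity.\<close>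

definition ballot_sets :: "nat \<Rightarrow> nat set set" where
  "ballot_sets n = {A. A \<subseteq> {1..n} \<and> (\<forall>x\<in>A. 2 * card (A \<inter> {..x}) < x)}"

lemma circular_peaks_subset:
  assumes "\<sigma> permutes {1..n}"
  shows "circular_peaks n \<sigma> \<subseteq> {1..n}"
proof
  fix x assume "x \<in> circular_peaks n \<sigma>"
  then obtain i where "x = \<sigma> i" "2 \<le> i" "i \<le> n - 1" by (auto simp: circular_peaks_def)
  then show "x \<in> {1..n}" using permutes_in_image[OF assms, of i] by auto
qed

text \<open>The positions of the c peaks with value at most x, their left neighbours, and the right
  neighbour of the last one are pairwise distinct and carry values in [x]; hence 2c + 1 \<le>
  x.\<close>

lemma circular_peaks_ballot:
  assumes \<sigma>: "\<sigma> permutes {1..n}"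
  shows "circular_peaks n \<sigma> \<in> ballot_sets n"
proof -
  have inj: "inj \<sigma>" using \<sigma> by (rule permutes_inj)
  define pk where "pk i \<longleftrightarrow> 2 \<le> i \<and> i \<le> n - 1 \<and> \<sigma> (i - 1) < \<sigma> i \<and> \<sigma> i > \<sigma> (i + 1)" for i
  have "2 * card (circular_peaks n \<sigma> \<inter> {..x}) < x" if x: "x \<in> circular_peaks n \<sigma>" for x
  proof -
    define P where "P = {i. pk i \<and> \<sigma> i \<le> x}"
    have "P \<subseteq> {..n}" by (auto simp: P_def pk_def)
    then have finP: "finite P" by (rule finite_subset) simp
    obtain i0 where "pk i0" "x = \<sigma> i0" using x by (auto simp: circular_peaks_def pk_def)
    then have Pne: "P \<noteq> {}" by (auto simp: P_def)
    define M where "M = Max P"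
    have M: "M \<in> P" "\<And>i. i \<in> P \<Longrightarrow> i \<le> M"
      using finP Pne by (auto simp: M_def)
    have img: "circular_peaks n \<sigma> \<inter> {..x} = \<sigma> ` P"
      by (auto simp: circular_peaks_def P_def pk_def)
    have cA: "card (circular_peaks n \<sigma> \<inter> {..x}) = card P"
      unfolding img by (intro card_image inj_on_subset[OF inj]) auto
    define L where "L = (\<lambda>i. i - 1) ` P"
    have cL: "card L = card P"
      unfolding L_def by (intro card_image) (auto simp: inj_on_def P_def pk_def)
    have M1: "M + 1 \<notin> L" "M + 1 \<notin> P" using M(2) by (force simp: L_def)+
    \<comment> \<open>Two adjacent positions cannot both be peaks.\<close>
    have dis: "P \<inter> L = {}" by (auto simp: L_def P_def pk_def)
    have "card (insert (M + 1) (P \<union> L)) = 2 * card P + 1"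
      using M1 dis finP cL by (simp add: card_Un_disjoint L_def)
    moreover have "card (insert (M + 1) (P \<union> L)) = card (\<sigma> ` insert (M + 1) (P \<union> L))"
      by (intro card_image[symmetric] inj_on_subset[OF inj]) auto
    moreover have "\<sigma> ` insert (M + 1) (P \<union> L) \<subseteq> {1..x}"
    proof -
      have "\<sigma> i \<le> x" if "i \<in> insert (M + 1) (P \<union> L)" for i
        using that M(1) by (auto simp: L_def P_def pk_def)
      moreover have "i \<in> {1..n}" if "i \<in> insert (M + 1) (P \<union> L)" for i
        using that M(1) by (auto simp: L_def P_def pk_def)
      ultimately show ?thesis using permutes_in_image[OF \<sigma>] by fastforce
    qed
    then have "card (\<sigma> ` insert (M + 1) (P \<union> L)) \<le> x"
      using card_mono[of "{1..x}"] by force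
    ultimately show ?thesis using cA by linarith
  qed
  then show ?thesis using circular_peaks_subset[OF \<sigma>] by (auto simp: ballot_sets_def)
qed

text \<open>If the entry at index j were at least x, sortedness would confine the elements below x
  to indices less than j, leaving at most j of them.\<close>

lemma sorted_list_of_set_nth_less:
  fixes T :: "nat set"
  assumes "finite T" "j < card {y \<in> T. y < x}"
  shows "sorted_list_of_set T ! j < x"
proof (rule ccontr)
  let ?t = "sorted_list_of_set T"
  assume ge: "\<not> ?t ! j < x"
  have "{y \<in> T. y < x} \<subseteq> (!) ?t ` {..<j}"
  proof
    fix y assume y: "y \<in> {y \<in> T. y < x}"
    then have "y \<in> set ?t" using assms by simp
    then obtain l where l: "l < length ?t" "?t ! l = y" by (meson in_set_conv_nth)
    have "l < j"
    proof (rule ccontr)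
      assume "\<not> l < j"
      then have "?t ! j \<le> ?t ! l" using l by (intro sorted_nth_mono) auto
      then show False using l ge y by simp
    qed
    then show "y \<in> (!) ?t ` {..<j}" using l by auto
  qed
  then have "card {y \<in> T. y < x} \<le> card ((!) ?t ` {..<j})" by (intro card_mono) auto
  also have "\<dots> \<le> j" using card_image_le[of "{..<j}" "(!) ?t"] by simp
  finally show False using assms by simp
qed

text \<open>The ballot condition at the largest element of \<open>A\<close> counts all of
  \<open>A\<close>; for empty \<open>A\<close> the claim is \<open>n \<ge> 1\<close>.\<close>

lemma ballot_card_less:
  assumes A: "A \<in> ballot_sets n" and n: "n \<ge> 1"
  shows "2 * card A < n"
proof (cases "A = {}")
  case False
  have fin: "finite A" using A finite_subset[of A "{1..n}"] by (auto simp: ballot_sets_def)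
  then have "Max A \<in> A" "A \<inter> {..Max A} = A" using False by auto
  then have "2 * card A < Max A" using A by (auto simp: ballot_sets_def)
  also have "Max A \<le> n" using \<open>Max A \<in> A\<close> A by (auto simp: ballot_sets_def)
  finally show ?thesis .
qed (use n in simp)

text \<open>The elements of \<open>A\<close> occupy the positions 2, 4, ..., 2k and the complement
  fills the other positions in increasing order. Each element of \<open>A\<close> is then flanked by
  two complement elements, which the ballot condition forces to be smaller.\<close>

lemma ballot_sets_realizable:
  assumes A: "A \<in> ballot_sets n" and n: "n \<ge> 1"
  shows "\<exists>\<sigma>. \<sigma> permutes {1..n} \<and> circular_peaks n \<sigma> = A"
proof -
  define T where "T = {1..n} - A"
  define k where "k = card A"
  define s where "s = sorted_list_of_set A"
  define t where "t = sorted_list_of_set T"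
  have sub: "A \<subseteq> {1..n}" using A by (simp add: ballot_sets_def)
  have fin: "finite A" "finite T" using sub finite_subset by (auto simp: T_def)
  have k: "2 * k < n" unfolding k_def by (rule ballot_card_less[OF A n])
  have cT: "card T = n - k" unfolding T_def k_def using sub fin by (simp add: card_Diff_subset)
  have ls: "length s = k" "set s = A" "distinct s" "sorted s" using fin by (auto simp: s_def k_def)
  have lt: "length t = n - k" "set t = T" "distinct t" "sorted t" using fin cT by (auto simp: t_def)
  \<comment> \<open>Of the numbers up to x = \<open>s ! j\<close>, some c \<ge> j + 1 lie in
    \<open>A\<close> and the other x - c > c lie in the complement, which therefore has at least j +
    2 elements below x. The bound \<open>l \<le> j + 1\<close> covers both neighbours
    \<open>t ! j\<close> and \<open>t ! (j + 1)\<close>.\<close>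
  have less: "t ! l < s ! j" if j: "j < k" "l \<le> j + 1" for j l
  proof -
    define x where "x = s ! j"
    have xA: "x \<in> A" using j ls nth_mem by (auto simp: x_def)
    have "(!) s ` {..j} \<subseteq> A \<inter> {..x}"
    proof
      fix y assume "y \<in> (!) s ` {..j}"
      then obtain i where i: "i \<le> j" "y = s ! i" by auto
      then have "y \<le> x" unfolding x_def using j ls by (simp add: sorted_nth_mono)
      moreover have "y \<in> A" using i j ls nth_mem by force
      ultimately show "y \<in> A \<inter> {..x}" by simp
    qed
    then have "card ((!) s ` {..j}) \<le> card (A \<inter> {..x})" using fin by (intro card_mono) auto
    moreover have "card ((!) s ` {..j}) = j + 1"
      using ls j by (subst card_image) (auto simp: inj_on_def nth_eq_iff_index_eq)
    ultimately have c: "j + 1 \<le> card (A \<inter> {..x})" by simp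
    have b: "2 * card (A \<inter> {..x}) < x" using A xA by (auto simp: ballot_sets_def)
    have "{y \<in> T. y < x} = {1..x} - (A \<inter> {..x})"
      using xA sub by (auto simp: T_def) (metis le_neq_implies_less)
    moreover have "card ({1..x} - (A \<inter> {..x})) = x - card (A \<inter> {..x})"
      using fin sub by (subst card_Diff_subset) auto
    ultimately have "l < card {y \<in> T. y < x}" using b c j by simp
    then show ?thesis unfolding t_def x_def[symmetric]
      using fin by (intro sorted_list_of_set_nth_less) auto
  qed
  have tmono: "t ! i < t ! j" if "i < j" "j < n - k" for i j
    using sorted_wrt_nth_less[of "(<)" t i j] that lt by (simp add: strict_sorted_iff)
  \<comment> \<open>The word is \<open>t\<^sub>0 s\<^sub>0 t\<^sub>1 s\<^sub>1 \<dots> s\<^sub>k\<^sub>-\<^sub>1 t\<^sub>k t\<^sub>k\<^sub>+\<^sub>1 \<dots>\<close>; \<open>g\<close> is the index into \<open>t\<close>.\<close>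
  define g where "g i = (if i \<le> 2 * k then (i - 1) div 2 else i - k - 1)" for i
  define \<sigma> where "\<sigma> i = (if i \<in> {1..n} then if even i \<and> i \<le> 2 * k then s ! (i div 2 - 1) else t ! g i else i)" for i
  have \<sigma>e: "\<sigma> i = s ! (i div 2 - 1)" "i div 2 - 1 < k" if "i \<in> {1..n}" "even i \<and> i \<le> 2 * k" for i
    using that by (auto simp: \<sigma>_def elim!: evenE)
  have \<sigma>o: "\<sigma> i = t ! g i" "g i < n - k" if "i \<in> {1..n}" "\<not> (even i \<and> i \<le> 2 * k)" for i
    using that k by (auto simp: \<sigma>_def g_def)
  have ginj: "i = j" if "i \<in> {1..n}" "\<not> (even i \<and> i \<le> 2 * k)"
      "j \<in> {1..n}" "\<not> (even j \<and> j \<le> 2 * k)" "g i = g j" for i j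
    using that by (auto simp: g_def split: if_splits elim!: oddE)
  \<comment> \<open>The position alone decides whether a letter comes from \<open>A\<close> or from
    \<open>T\<close>, so injectivity reduces to comparing indices within \<open>s\<close> or within
    \<open>t\<close>.\<close>
  have AT: "\<sigma> i \<in> A \<longleftrightarrow> even i \<and> i \<le> 2 * k" "\<sigma> i \<in> T \<longleftrightarrow> \<not> (even i \<and> i \<le> 2 * k)" if "i \<in> {1..n}" for i
  proof -
    have "\<sigma> i \<in> A" if "even i \<and> i \<le> 2 * k"
      using \<sigma>e[OF \<open>i \<in> {1..n}\<close> that] ls nth_mem[of _ s] by auto
    moreover have "\<sigma> i \<in> T" if "\<not> (even i \<and> i \<le> 2 * k)"
      using \<sigma>o[OF \<open>i \<in> {1..n}\<close> that] lt nth_mem[of _ t] by auto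
    moreover have "A \<inter> T = {}" by (auto simp: T_def)
    ultimately show "\<sigma> i \<in> A \<longleftrightarrow> even i \<and> i \<le> 2 * k" "\<sigma> i \<in> T \<longleftrightarrow> \<not> (even i \<and> i \<le> 2 * k)" by blast+
  qed
  have inj: "inj_on \<sigma> {1..n}"
  proof
    fix i j assume ij: "i \<in> {1..n}" "j \<in> {1..n}" "\<sigma> i = \<sigma> j"
    show "i = j"
    proof (cases "even i \<and> i \<le> 2 * k")
      case True
      then have j: "even j \<and> j \<le> 2 * k" using AT ij by metis
      have "i div 2 - 1 = j div 2 - 1"
        using \<sigma>e[OF ij(1) True] \<sigma>e[OF ij(2) j] ij(3) ls by (simp add: nth_eq_iff_index_eq)
      then show ?thesis using True j ij by (auto elim!: evenE)
    next
      case False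
      then have j: "\<not> (even j \<and> j \<le> 2 * k)" using AT ij by metis
      have "g i = g j"
        using \<sigma>o[OF ij(1) False] \<sigma>o[OF ij(2) j] ij(3) lt by (simp add: nth_eq_iff_index_eq)
      then show ?thesis using ginj ij False j by blast
    qed
  qed
  have "\<sigma> i \<in> A \<union> T" if "i \<in> {1..n}" for i using AT[OF that] by blast
  moreover have "A \<union> T = {1..n}" using sub by (auto simp: T_def)
  ultimately have "\<sigma> ` {1..n} \<subseteq> {1..n}" by blast
  then have "\<sigma> ` {1..n} = {1..n}" using inj by (simp add: endo_inj_surj)
  then have bij: "bij_betw \<sigma> {1..n} {1..n}" using inj by (simp add: bij_betw_def)
  then have perm: "\<sigma> permutes {1..n}" by (rule bij_imp_permutes) (auto simp: \<sigma>_def)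
  have pk: "\<sigma> i \<in> A \<longleftrightarrow> \<sigma> (i - 1) < \<sigma> i \<and> \<sigma> i > \<sigma> (i + 1)" if i: "2 \<le> i" "i \<le> n - 1" for i
  proof (cases "even i \<and> i \<le> 2 * k")
    case True
    then obtain j where "i = 2 * j" "j \<le> k" by (auto elim!: evenE)
    then obtain l where l: "i = 2 * Suc l" "Suc l \<le> k" using i by (cases j) auto
    have g: "g (i - 1) = l" "g (i + 1) = Suc l" using l by (auto simp: g_def)
    have "\<sigma> i = s ! l" "\<sigma> (i - 1) = t ! l" "\<sigma> (i + 1) = t ! Suc l"
      using \<sigma>e[of i] \<sigma>o[of "i - 1"] \<sigma>o[of "i + 1"] l i g by auto
    then show ?thesis using True AT[of i] i l less[of l l] less[of l "Suc l"] by auto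
  next
    case False
    \<comment> \<open>A letter from the complement is followed by a larger one: before position 2k
      by an element of \<open>A\<close>, afterwards by the next entry of \<open>t\<close>.\<close>
    have "\<not> \<sigma> i > \<sigma> (i + 1)"
    proof (cases "i < 2 * k")
      case True
      then have od: "odd i" using False by auto
      then obtain j where j: "i = 2 * j + 1" by (auto elim!: oddE)
      have "\<sigma> i = t ! j" "\<sigma> (i + 1) = s ! j" using j i True by (auto simp: \<sigma>_def g_def)
      then show ?thesis using less[of j j] j True by auto
    next
      case ge: False
      have "i > 2 * k" using ge False by (cases "i = 2 * k") auto
      then have "\<sigma> i = t ! (i - k - 1)" "\<sigma> (i + 1) = t ! (i - k)" using i by (auto simp: \<sigma>_def g_def)
      moreover have "i - k - 1 < i - k" "i - k < n - k" using \<open>i > 2 * k\<close> i n by auto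
      ultimately show ?thesis using tmono[of "i - k - 1" "i - k"] by simp
    qed
    then show ?thesis using False AT[of i] i by auto
  qed
  have "circular_peaks n \<sigma> = A"
  proof
    show "circular_peaks n \<sigma> \<subseteq> A" using pk by (auto simp: circular_peaks_def)
    show "A \<subseteq> circular_peaks n \<sigma>"
    proof
      fix x assume x: "x \<in> A"
      then obtain i where i: "i \<in> {1..n}" "x = \<sigma> i" using sub \<open>\<sigma> ` {1..n} = {1..n}\<close> by blast
      then have "even i \<and> i \<le> 2 * k" using AT x by auto
      \<comment> \<open>Since 2k < n, an element of \<open>A\<close> never sits at the last
        position, so both neighbours exist.\<close>
      then have "2 \<le> i" "i \<le> n - 1" using i k by (auto elim!: evenE)
      then show "x \<in> circular_peaks n \<sigma>" using pk x i by (auto simp: circular_peaks_def)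
    qed
  qed
  then show ?thesis using perm by blast
qed

lemma CP_poset_eq_ballot_sets:
  assumes "n \<ge> 1"
  shows "CP_poset n = ballot_sets n"
proof
  show "CP_poset n \<subseteq> ballot_sets n"
    using circular_peaks_ballot by (auto simp: CP_poset_def CP_perms_def)
  show "ballot_sets n \<subseteq> CP_poset n"
  proof
    fix A assume A: "A \<in> ballot_sets n"
    then have "A \<subseteq> {1..n}" by (simp add: ballot_sets_def)
    then show "A \<in> CP_poset n"
      using ballot_sets_realizable[OF A assms] by (auto simp: CP_poset_def CP_perms_def)
  qed
qed

section \<open>Counting ballot sets by size\<close>

lemma finite_ballot_sets [simp]: "finite (ballot_sets n)"
  by (rule finite_subset[of _ "Pow {1..n}"]) (auto simp: ballot_sets_def)

lemma ballot_sets_finite: "A \<in> ballot_sets n \<Longrightarrow> finite A"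
  using finite_subset[of A "{1..n}"] by (auto simp: ballot_sets_def)

text \<open>Passing to a subset can only lower the counts |A \<inter> [x]|.\<close>

lemma ballot_sets_subset_closed:
  assumes "A \<in> ballot_sets n" "B \<subseteq> A"
  shows "B \<in> ballot_sets n"
proof -
  have fin: "finite A" using assms(1) by (rule ballot_sets_finite)
  have "2 * card (B \<inter> {..x}) < x" if "x \<in> B" for x
  proof -
    have "card (B \<inter> {..x}) \<le> card (A \<inter> {..x})" using fin assms(2) by (intro card_mono) auto
    moreover have "2 * card (A \<inter> {..x}) < x" using assms that by (auto simp: ballot_sets_def)
    ultimately show ?thesis by linarith
  qed
  then show ?thesis using assms by (auto simp: ballot_sets_def)
qed

text \<open>The tests at elements of \<open>A\<close> do not see \<open>Suc n\<close>. The one new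
  test, at \<open>Suc n\<close> itself, counts the whole set and reads 2 (|A| + 1) < n + 1.\<close>

lemma ballot_sets_insert_iff:
  assumes "A \<subseteq> {1..n}"
  shows "insert (Suc n) A \<in> ballot_sets (Suc n) \<longleftrightarrow> A \<in> ballot_sets n \<and> Suc (2 * card A) < n"
proof -
  have fin: "finite A" "Suc n \<notin> A" using assms finite_subset by auto
  have 1: "insert (Suc n) A \<inter> {..x} = A \<inter> {..x}" if "x \<in> A" for x using that assms by auto
  have 2: "insert (Suc n) A \<inter> {..Suc n} = insert (Suc n) A" using assms by auto
  have sub: "insert (Suc n) A \<subseteq> {1..Suc n}" using assms by auto
  have "insert (Suc n) A \<in> ballot_sets (Suc n) \<longleftrightarrow>
      2 * card (insert (Suc n) A) < Suc n \<and> (\<forall>x\<in>A. 2 * card (A \<inter> {..x}) < x)"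
    unfolding ballot_sets_def using sub 1 2 by simp
  also have "2 * card (insert (Suc n) A) < Suc n \<longleftrightarrow> Suc (2 * card A) < n" using fin by auto
  finally show ?thesis using assms unfolding ballot_sets_def by blast
qed

definition ballot_count :: "nat \<Rightarrow> nat \<Rightarrow> nat" where
  "ballot_count n s = card {A \<in> ballot_sets n. card A = s}"

lemma ballot_count_0: "ballot_count n 0 = 1"
proof -
  have "A = {}" if "A \<in> ballot_sets n" "card A = 0" for A
    using that ballot_sets_finite[of A n] by simp
  moreover have "{} \<in> ballot_sets n" by (simp add: ballot_sets_def)
  ultimately have "{A \<in> ballot_sets n. card A = 0} = {{}}" by auto
  then show ?thesis by (simp add: ballot_count_def)
qed

lemma ballot_count_eq_0:
  assumes "n \<ge> 1" "2 * s \<ge> n"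
  shows "ballot_count n s = 0"
proof -
  have "{A \<in> ballot_sets n. card A = s} = {}"
    using ballot_card_less[OF _ assms(1)] assms(2) by fastforce
  then show ?thesis by (simp add: ballot_count_def)
qed

text \<open>Split by whether \<open>Suc n\<close> belongs to the set. The hypothesis is exactly the
  new test for an s-element set enlarged by \<open>Suc n\<close>, so every such extension is
  admissible.\<close>

lemma ballot_count_Suc:
  assumes "Suc (2 * s) < n"
  shows "ballot_count (Suc n) (Suc s) = ballot_count n (Suc s) + ballot_count n s"
proof -
  let ?F = "\<lambda>n s. {A \<in> ballot_sets n. card A = s}"
  have un: "?F (Suc n) (Suc s) = ?F n (Suc s) \<union> insert (Suc n) ` ?F n s" (is "?L = ?R")
  proof (intro equalityI subsetI)
    fix A assume A: "A \<in> ?L"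
    then have sub: "A \<subseteq> {1..Suc n}" and fin: "finite A"
      using A ballot_sets_finite[of A "Suc n"] by (auto simp: ballot_sets_def)
    show "A \<in> ?R"
    proof (cases "Suc n \<in> A")
      case True
      have "A - {Suc n} \<subseteq> {1..n}" using sub by (auto simp: atLeastAtMostSuc_conv)
      moreover have "insert (Suc n) (A - {Suc n}) = A" using True by auto
      ultimately have "A - {Suc n} \<in> ?F n s" "A = insert (Suc n) (A - {Suc n})"
        using ballot_sets_insert_iff[of "A - {Suc n}" n] A fin True by auto
      then show ?thesis by blast
    next
      case False
      then have "A \<subseteq> {1..n}" using sub by (auto simp: atLeastAtMostSuc_conv)
      then show ?thesis using A by (auto simp: ballot_sets_def)
    qed
  next
    fix A assume "A \<in> ?R"
    then consider "A \<in> ?F n (Suc s)" | B where "B \<in> ?F n s" "A = insert (Suc n) B" by auto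
    then show "A \<in> ?L"
    proof cases
      case 1
      then show ?thesis by (auto simp: ballot_sets_def)
    next
      case 2
      then have "B \<subseteq> {1..n}" by (auto simp: ballot_sets_def)
      moreover from this have "Suc n \<notin> B" "finite B" using finite_subset by auto
      ultimately show ?thesis using 2 assms ballot_sets_insert_iff[of B n] by auto
    qed
  qed
  have dis: "?F n (Suc s) \<inter> insert (Suc n) ` ?F n s = {}"
    by (auto simp: ballot_sets_def)
  have inj: "inj_on (insert (Suc n)) (?F n s)"
  proof
    fix A B assume AB: "A \<in> ?F n s" "B \<in> ?F n s" "insert (Suc n) A = insert (Suc n) B"
    then have "Suc n \<notin> A" "Suc n \<notin> B" by (auto simp: ballot_sets_def)
    then show "A = B" using AB(3) insert_ident by metis
  qed
  show ?thesis
    unfolding ballot_count_def un by (subst card_Un_disjoint) (use dis inj in \<open>simp_all add: card_image\<close>)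
qed

text \<open>Induction on \<open>n\<close> by the Pascal-type recurrence, with the denominator
  \<open>n\<close> cleared. The range includes \<open>2 * s = n\<close>, where both sides vanish,
  because the recurrence for \<open>Suc n\<close> may call on that boundary value.\<close>

lemma ballot_count_formula:
  assumes "n \<ge> 1" "2 * s \<le> n"
  shows "rat_of_nat n * of_nat (ballot_count n s) = of_nat (n choose s) * (of_nat n - 2 * of_nat s)"
  using assms
proof (induction n arbitrary: s rule: nat_induct_at_least)
  case base
  then have "s = 0" by simp
  then show ?case by (simp add: ballot_count_0)
next
  case (Suc n s)
  consider "s = 0" | "2 * s = Suc n" | r where "s = Suc r" "Suc (2 * r) < n" "2 * Suc r \<le> n"
    using Suc.prems by (cases s) (auto simp: le_Suc_eq)
  then show ?case
  proof cases
    case 1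
    then show ?thesis by (simp add: ballot_count_0)
  next
    case 2
    then have "(2::rat) * of_nat s = of_nat (Suc n)" by (metis of_nat_mult of_nat_numeral)
    then show ?thesis using 2 ballot_count_eq_0[of "Suc n" s] by simp
  next
    case 3
    \<comment> \<open>After multiplication by \<open>R + 1\<close>, the binomials (n choose r + 1)
      and (n + 1 choose r + 1) both become multiples of c, which leaves polynomial identities in
      \<open>N\<close> and \<open>R\<close>.\<close>
    define c where "c = rat_of_nat (n choose r)"
    define N R where "N = rat_of_nat n" and "R = rat_of_nat r"
    have nz: "R + 1 \<noteq> 0" "N \<noteq> 0" using Suc.hyps by (auto simp: R_def N_def add_eq_0_iff)
    have "Suc r * (n choose Suc r) = (n - r) * (n choose r)"
      using binomial_absorb_comp[of n r] binomial_absorption[of r n] Suc_times_binomial_eq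
      by (metis binomial_fact_lemma choose_mult_lemma mult.commute)
    then have c1: "(R + 1) * of_nat (n choose Suc r) = (N - R) * c"
      unfolding c_def N_def R_def using 3
      by (metis Suc_eq_plus1 add_lessD1 mult_2 nat_less_le of_nat_Suc of_nat_diff of_nat_mult add.commute)
    have "Suc r * (Suc n choose Suc r) = Suc n * (n choose r)"
      by (metis Suc_times_binomial_eq mult.commute)
    then have c2: "(R + 1) * of_nat (Suc n choose Suc r) = (N + 1) * c"
      unfolding c_def N_def R_def by (metis of_nat_Suc of_nat_mult add.commute)
    have h1: "N * of_nat (ballot_count n r) = c * (N - 2 * R)"
      using Suc.IH[of r] 3 by (simp add: c_def N_def R_def)
    have h2: "N * of_nat (ballot_count n (Suc r)) = of_nat (n choose Suc r) * (N - 2 * (R + 1))"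
      using Suc.IH[of "Suc r"] 3 by (simp add: N_def R_def algebra_simps)
    have "ballot_count (Suc n) s = ballot_count n (Suc r) + ballot_count n r"
      using 3 ballot_count_Suc by simp
    then have "(R + 1) * (N * of_nat (ballot_count (Suc n) s))
       = (R + 1) * (N * of_nat (ballot_count n (Suc r))) + (R + 1) * (N * of_nat (ballot_count n r))"
      by (simp add: distrib_left)
    also have "\<dots> = ((R + 1) * of_nat (n choose Suc r)) * (N - 2 * (R + 1)) + (R + 1) * (c * (N - 2 * R))"
      by (simp only: h1 h2 mult.assoc)
    \<comment> \<open>This is (N - R)(N - 2R - 2) + (R + 1)(N - 2R) = N (N - 2R - 1); the factor N
      is cancelled next.\<close>
    also have "\<dots> = N * (c * (N - 2 * R - 1))"
      unfolding c1 by (simp add: algebra_simps)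
    finally have "N * ((R + 1) * of_nat (ballot_count (Suc n) s)) = N * (c * (N - 2 * R - 1))"
      by (simp only: mult.left_commute)
    then have e: "(R + 1) * of_nat (ballot_count (Suc n) s) = c * (N - 2 * R - 1)"
      using nz(2) mult_left_cancel by blast
    have "(R + 1) * ((N + 1) * of_nat (ballot_count (Suc n) s))
        = (N + 1) * ((R + 1) * of_nat (ballot_count (Suc n) s))"
      by (rule mult.left_commute)
    also have "\<dots> = ((N + 1) * c) * (N + 1 - 2 * (R + 1))"
      unfolding e by (simp add: algebra_simps)
    also have "\<dots> = (R + 1) * (of_nat (Suc n choose s) * (N + 1 - 2 * (R + 1)))"
      unfolding c2[symmetric] 3(1) by (rule mult.assoc)
    finally have "(N + 1) * of_nat (ballot_count (Suc n) s) = of_nat (Suc n choose s) * (N + 1 - 2 * (R + 1))"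
      using nz(1) mult_left_cancel by blast
    moreover have "rat_of_nat (Suc n) = N + 1" "rat_of_nat s = R + 1"
      using 3 by (simp_all add: N_def R_def)
    ultimately show ?thesis by (simp add: add.commute)
  qed
qed

section \<open>Multinomial sums over block sizes\<close>

lemma prod_fact_dvd_fact_sum:
  assumes "finite I"
  shows "(\<Prod>k\<in>I. fact (d k)) dvd (fact (\<Sum>k\<in>I. d k) :: nat)"
  using assms
proof induction
  case (insert x I)
  have "fact (d x) * (\<Prod>k\<in>I. fact (d k)) dvd (fact (d x) * fact (\<Sum>k\<in>I. d k) :: nat)"
    using insert.IH by simp
  also have "\<dots> dvd fact (d x + (\<Sum>k\<in>I. d k))" by (rule fact_fact_dvd_fact)
  finally show ?case using insert.hyps by simp
qed simp

text \<open>The product of the factorials divides n!, so the truncating division is exact and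
  multinomials can be handled as quotients in a field.\<close>

lemma of_nat_multinomial:
  assumes "finite I" "(\<Sum>k\<in>I. d k) = n"
  shows "rat_of_nat (multinomial n I d) = fact n / (\<Prod>k\<in>I. fact (d k))"
proof -
  obtain q where q: "(fact n :: nat) = (\<Prod>k\<in>I. fact (d k)) * q"
    using prod_fact_dvd_fact_sum[OF assms(1), of d] assms(2) by (auto elim: dvdE)
  then have "rat_of_nat (fact n) = of_nat (\<Prod>k\<in>I. fact (d k)) * of_nat q"
    by (metis of_nat_mult)
  moreover have "multinomial n I d = q"
    unfolding multinomial_def q using assms(1) by simp
  ultimately show ?thesis using assms(1) by simp
qed

text \<open>These are the block sizes of a chain of i sets whose top has size s. The first entry is
  the size of the smallest member, which may be empty; each later one is the size of a difference of
  consecutive members, hence positive.\<close>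

definition chain_tuples :: "nat \<Rightarrow> nat \<Rightarrow> (nat \<Rightarrow> nat) set" where
  "chain_tuples i s =
     {d \<in> {1..i} \<rightarrow>\<^sub>E UNIV. (\<Sum>k = 1..i. d k) = s \<and> (\<forall>k. 2 \<le> k \<and> k \<le> i \<longrightarrow> d k \<ge> 1)}"

text \<open>For \<open>i \<ge> 1\<close> this is the number of chains of i subsets of an s-element
  set that contain the set itself; a tuple contributes the ordered partitions with its block
  sizes.\<close>

definition chain_weight :: "nat \<Rightarrow> nat \<Rightarrow> rat" where
  "chain_weight i s = (\<Sum>d \<in> chain_tuples i s. of_nat (multinomial s {1..i} d))"

lemma finite_chain_tuples: "finite (chain_tuples i s)"
proof (rule finite_subset)
  show "chain_tuples i s \<subseteq> {1..i} \<rightarrow>\<^sub>E {..s}"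
  proof
    fix d assume d: "d \<in> chain_tuples i s"
    have "d k \<le> s" if "k \<in> {1..i}" for k
      using d member_le_sum[of k "{1..i}" d] that by (auto simp: chain_tuples_def)
    then show "d \<in> {1..i} \<rightarrow>\<^sub>E {..s}" using d
      by (auto simp: chain_tuples_def PiE_iff)
  qed
qed (simp add: finite_PiE)

text \<open>With r the sum of the first i entries, the multinomial coefficient is (n choose r) times
  that of the first i entries. The condition \<open>P\<close> and the weight \<open>f\<close> on the
  last entry stay general to serve both the recurrence for \<open>chain_weight\<close> and the
  Hilbert coefficients.\<close>

lemma sum_split_last_entry:
  fixes f :: "nat \<Rightarrow> rat"
  shows "(\<Sum>d \<in> {d \<in> {1..Suc i} \<rightarrow>\<^sub>E UNIV. (\<Sum>k = 1..Suc i. d k) = n \<and>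
             (\<forall>k. 2 \<le> k \<and> k \<le> i \<longrightarrow> d k \<ge> 1) \<and> P (d (Suc i))}.
            of_nat (multinomial n {1..Suc i} d) * f (d (Suc i)))
         = (\<Sum>r | r \<le> n \<and> P (n - r). of_nat (n choose r) * chain_weight i r * f (n - r))"
    (is "sum ?g ?D = _")
proof -
  let ?R = "{r. r \<le> n \<and> P (n - r)}"
  have "(\<Sum>r\<in>?R. of_nat (n choose r) * chain_weight i r * f (n - r))
      = (\<Sum>r\<in>?R. \<Sum>d\<in>chain_tuples i r. of_nat (n choose r) * of_nat (multinomial r {1..i} d) * f (n - r))"
    by (simp add: chain_weight_def sum_distrib_left sum_distrib_right)
  also have "\<dots> = (\<Sum>(r, d)\<in>(SIGMA r:?R. chain_tuples i r).
      of_nat (n choose r) * of_nat (multinomial r {1..i} d) * f (n - r))"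
    by (rule sum.Sigma) (auto simp: finite_chain_tuples)
  also have "\<dots> = sum ?g ?D"
  \<comment> \<open>The bijection removes the last entry n - r and records r; the removed position
    is reset to \<open>undefined\<close> because the shorter tuples are extensional.\<close>
  proof (rule sum.reindex_bij_witness[of _ "\<lambda>d. (n - d (Suc i), d(Suc i := undefined))"
        "\<lambda>(r, d). d(Suc i := n - r)"])
    fix x assume x: "x \<in> (SIGMA r:?R. chain_tuples i r)"
    obtain r d where rd: "x = (r, d)" by fastforce
    let ?d = "d(Suc i := n - r)"
    have r: "r \<le> n" "P (n - r)" and d: "d \<in> chain_tuples i r" using x rd by auto
    have und: "d (Suc i) = undefined" using d by (auto simp: chain_tuples_def PiE_iff extensional_def)
    show "(\<lambda>d. (n - d (Suc i), d(Suc i := undefined))) ((\<lambda>(r, d). d(Suc i := n - r)) x) = x"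
      using rd r und by (simp add: fun_upd_idem)
    have ds: "(\<Sum>k = 1..i. d k) = r" using d by (simp add: chain_tuples_def)
    then have s: "(\<Sum>k = 1..i. ?d k) = r" by simp
    have s': "(\<Sum>k = 1..Suc i. ?d k) = n" using s r by simp
    show "(\<lambda>(r, d). d(Suc i := n - r)) x \<in> ?D"
      using rd r d s' by (auto simp: chain_tuples_def PiE_iff extensional_def)
    have p: "(\<Prod>k = 1..Suc i. fact (?d k)) = fact (n - r) * (\<Prod>k = 1..i. fact (d k) :: rat)"
      by simp
    have "(\<Prod>k = 1..i. fact (d k)) \<noteq> (0::rat)" by simp
    then have "rat_of_nat (multinomial n {1..Suc i} ?d) = of_nat (n choose r) * of_nat (multinomial r {1..i} d)"
      unfolding of_nat_multinomial[OF finite_atLeastAtMost s']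
        of_nat_multinomial[OF finite_atLeastAtMost ds] binomial_fact[OF r(1)] p
      by simp
    then show "?g ((\<lambda>(r, d). d(Suc i := n - r)) x) =
      (case x of (r, d) \<Rightarrow> of_nat (n choose r) * of_nat (multinomial r {1..i} d) * f (n - r))"
      using rd by simp
  next
    fix d assume d: "d \<in> ?D"
    let ?r = "n - d (Suc i)" and ?d = "d(Suc i := undefined)"
    have le: "d (Suc i) \<le> n" using d by auto
    then show "(\<lambda>(r, d). d(Suc i := n - r)) ((\<lambda>d. (n - d (Suc i), d(Suc i := undefined))) d) = d"
      by auto
    have "(\<Sum>k = 1..i. ?d k) = ?r" using d by auto
    then show "(\<lambda>d. (n - d (Suc i), d(Suc i := undefined))) d \<in> (SIGMA r:?R. chain_tuples i r)"
      using d le by (auto simp: chain_tuples_def PiE_iff extensional_def)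
  qed
  finally show ?thesis ..
qed

section \<open>Chains of ballot sets\<close>

definition subset_chains :: "'a set set \<Rightarrow> nat \<Rightarrow> 'a set set set" where
  "subset_chains F k = {C. C \<subseteq> F \<and> card C = k \<and> (\<forall>X\<in>C. \<forall>Y\<in>C. X \<subseteq> Y \<or> Y \<subseteq> X)}"

definition chains_with_top :: "'a set \<Rightarrow> nat \<Rightarrow> 'a set set set" where
  "chains_with_top A k = {C \<in> subset_chains (Pow A) k. A \<in> C}"

lemma finite_subset_chains: "finite F \<Longrightarrow> finite (subset_chains F k)"
  by (rule finite_subset[of _ "Pow F"]) (auto simp: subset_chains_def)

text \<open>A nonempty finite chain contains its union, which is its unique top. Downward closure of
  \<open>F\<close> makes every chain of subsets of the top a chain in \<open>F\<close>, so the count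
  for a given top no longer depends on \<open>F\<close>.\<close>

lemma card_subset_chains_eq_sum:
  assumes fin: "finite F" and k: "k \<ge> 1"
    and down: "\<And>A B. A \<in> F \<Longrightarrow> B \<subseteq> A \<Longrightarrow> B \<in> F"
  shows "card (subset_chains F k) = (\<Sum>A\<in>F. card (chains_with_top A k))"
proof -
  have "subset_chains F k = (\<Union>A\<in>F. chains_with_top A k)"
  proof (intro equalityI subsetI)
    fix C assume C: "C \<in> subset_chains F k"
    then have "finite C" using fin finite_subset by (auto simp: subset_chains_def)
    moreover have "C \<noteq> {}" using C k by (auto simp: subset_chains_def)
    moreover have "subset.chain F C" using C by (auto simp: subset_chains_def subset_chain_def)
    ultimately have "\<Union>C \<in> C" by (rule Union_in_chain)
    then show "C \<in> (\<Union>A\<in>F. chains_with_top A k)"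
      using C by (auto simp: subset_chains_def chains_with_top_def intro!: bexI[of _ "\<Union>C"])
  next
    fix C assume "C \<in> (\<Union>A\<in>F. chains_with_top A k)"
    then show "C \<in> subset_chains F k"
      using down by (auto simp: subset_chains_def chains_with_top_def)
  qed
  also have "card \<dots> = (\<Sum>A\<in>F. card (chains_with_top A k))"
  proof (rule card_UN_disjoint)
    have "chains_with_top A k \<subseteq> subset_chains F k" if "A \<in> F" for A
      using down[OF that] by (auto simp: subset_chains_def chains_with_top_def)
    then show "\<forall>A\<in>F. finite (chains_with_top A k)"
      using finite_subset_chains[OF fin] finite_subset by blast
    have "A = B" if "C \<in> chains_with_top A k" "C \<in> chains_with_top B k" for A B and C :: "'a set set"
      using that by (auto simp: subset_chains_def chains_with_top_def)
    then show "\<forall>A\<in>F. \<forall>B\<in>F. A \<noteq> B \<longrightarrow> chains_with_top A k \<inter> chains_with_top B k = {}"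
      by blast
  qed (fact fin)
  finally show ?thesis .
qed

text \<open>Deleting and restoring the top \<open>A\<close> are inverse to each other.\<close>

lemma card_chains_with_top_Suc:
  assumes "finite A"
  shows "card (chains_with_top A (Suc i)) = card (subset_chains {B. B \<subset> A} i)"
proof -
  have fin: "finite C" if "C \<subseteq> Pow A" for C using assms that finite_subset by blast
  have "bij_betw (insert A) (subset_chains {B. B \<subset> A} i) (chains_with_top A (Suc i))"
  proof (rule bij_betw_byWitness[where f' = "\<lambda>C. C - {A}"])
    show "\<forall>C\<in>subset_chains {B. B \<subset> A} i. insert A C - {A} = C"
      by (auto simp: subset_chains_def)
    show "\<forall>C\<in>chains_with_top A (Suc i). insert A (C - {A}) = C"
      by (auto simp: chains_with_top_def)
    show "insert A ` subset_chains {B. B \<subset> A} i \<subseteq> chains_with_top A (Suc i)"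
    proof
      fix D assume "D \<in> insert A ` subset_chains {B. B \<subset> A} i"
      then obtain C where C: "C \<in> subset_chains {B. B \<subset> A} i" and D: "D = insert A C" by auto
      have sub: "C \<subseteq> {B. B \<subset> A}" using C by (simp add: subset_chains_def)
      then have "finite C" "A \<notin> C" using fin by blast+
      moreover have "C \<subseteq> Pow A" using sub by auto
      ultimately show "D \<in> chains_with_top A (Suc i)"
        using C unfolding D by (auto simp: subset_chains_def chains_with_top_def)
    qed
    show "(\<lambda>C. C - {A}) ` chains_with_top A (Suc i) \<subseteq> subset_chains {B. B \<subset> A} i"
    proof
      fix D assume "D \<in> (\<lambda>C. C - {A}) ` chains_with_top A (Suc i)"
      then obtain C where C: "C \<in> chains_with_top A (Suc i)" and D: "D = C - {A}" by auto
      have "card D = i" using C fin unfolding D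
        by (simp add: chains_with_top_def subset_chains_def)
      then show "D \<in> subset_chains {B. B \<subset> A} i"
        using C unfolding D by (auto simp: chains_with_top_def subset_chains_def)
    qed
  qed
  then show ?thesis by (simp add: bij_betw_same_card)
qed

lemma sum_card_eq:
  fixes g :: "nat \<Rightarrow> rat"
  assumes "finite F" "finite R" "card ` F \<subseteq> R"
  shows "(\<Sum>A\<in>F. g (card A)) = (\<Sum>r\<in>R. of_nat (card {A \<in> F. card A = r}) * g r)"
proof -
  have "(\<Sum>A\<in>F. g (card A)) = (\<Sum>r\<in>R. \<Sum>A\<in>{A \<in> F. card A = r}. g (card A))"
    using assms by (rule sum.group[symmetric])
  also have "\<dots> = (\<Sum>r\<in>R. of_nat (card {A \<in> F. card A = r}) * g r)"
    by (intro sum.cong) auto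
  finally show ?thesis .
qed

lemma chain_weight_1: "chain_weight 1 s = 1"
proof -
  have "chain_tuples 1 s = {\<lambda>k. if k = 1 then s else undefined}"
    by (auto simp: chain_tuples_def PiE_iff extensional_def fun_eq_iff)
  then show ?thesis by (simp add: chain_weight_def multinomial_def)
qed

text \<open>For \<open>i \<ge> 1\<close> the last index is at least 2, so the last entry is
  positive; splitting it off leaves a sum r < s, the size of the next set below the top.\<close>

lemma chain_weight_Suc:
  assumes "i \<ge> 1"
  shows "chain_weight (Suc i) s = (\<Sum>r<s. of_nat (s choose r) * chain_weight i r)"
proof -
  have "(\<forall>k. 2 \<le> k \<and> k \<le> Suc i \<longrightarrow> d k \<ge> 1) \<longleftrightarrow>
      (\<forall>k. 2 \<le> k \<and> k \<le> i \<longrightarrow> d k \<ge> 1) \<and> d (Suc i) \<ge> 1" for d :: "nat \<Rightarrow> nat"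
  proof -
    have "2 \<le> Suc i" using assms by simp
    then show ?thesis by (metis le_Suc_eq order_refl)
  qed
  then have "chain_tuples (Suc i) s = {d \<in> {1..Suc i} \<rightarrow>\<^sub>E UNIV. (\<Sum>k = 1..Suc i. d k) = s \<and>
             (\<forall>k. 2 \<le> k \<and> k \<le> i \<longrightarrow> d k \<ge> 1) \<and> d (Suc i) \<ge> 1}"
    unfolding chain_tuples_def by simp
  moreover have "{r. r \<le> s \<and> s - r \<ge> 1} = {..<s}" by auto
  ultimately show ?thesis
    using sum_split_last_entry[where i = i and n = s and P = "\<lambda>x. x \<ge> 1" and f = "\<lambda>_. 1"] by (simp add: chain_weight_def)
qed

text \<open>Deleting the top \<open>A\<close> and sorting the remaining chains by their own top, a
  proper subset of size r, gives the recurrence of \<open>chain_weight_Suc\<close>.\<close>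

lemma card_chains_with_top:
  assumes "i \<ge> 1" "finite A"
  shows "of_nat (card (chains_with_top A i)) = chain_weight i (card A)"
  using assms
proof (induction i arbitrary: A rule: nat_induct_at_least)
  case base
  have "chains_with_top A 1 = {{A}}"
    by (auto simp: chains_with_top_def subset_chains_def card_1_singleton_iff)
  then show ?case using chain_weight_1[of "card A"] by simp
next
  case (Suc i A)
  let ?F = "{B. B \<subset> A}"
  have fin: "finite ?F" using Suc.prems by (auto intro: finite_subset[of _ "Pow A"])
  have finB: "finite B" if "B \<in> ?F" for B using that Suc.prems finite_subset by auto
  have "card (chains_with_top A (Suc i)) = (\<Sum>B\<in>?F. card (chains_with_top B i))"
    unfolding card_chains_with_top_Suc[OF Suc.prems]
    by (rule card_subset_chains_eq_sum) (use fin Suc.hyps in auto)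
  also have "of_nat \<dots> = (\<Sum>B\<in>?F. chain_weight i (card B))"
    unfolding of_nat_sum by (intro sum.cong refl Suc.IH finB)
  also have "\<dots> = (\<Sum>r<card A. of_nat (card {B \<in> ?F. card B = r}) * chain_weight i r)"
    using Suc.prems fin by (intro sum_card_eq) (auto intro: psubset_card_mono)
  also have "\<dots> = (\<Sum>r<card A. of_nat (card A choose r) * chain_weight i r)"
  proof (intro sum.cong refl arg_cong2[where f = "(*)"] arg_cong[where f = of_nat])
    fix r assume "r \<in> {..<card A}"
    \<comment> \<open>For r < |A|, a subset of size r is automatically proper.\<close>
    then have "{B \<in> ?F. card B = r} = {B. B \<subseteq> A \<and> card B = r}" by auto
    then show "card {B \<in> ?F. card B = r} = card A choose r"
      using n_subsets[OF Suc.prems] by simp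
  qed
  also have "\<dots> = chain_weight (Suc i) (card A)"
    using chain_weight_Suc[OF Suc.hyps(1)] by simp
  finally show ?case .
qed

text \<open>Chains are grouped by the size r of their top. With last entry d = n - r, the ballot
  factor (n - 2r)/n becomes (2d - n)/n, and r \<le> (n - 1) div 2 becomes the lower bound on
  d.\<close>

lemma card_subset_chains_ballot_sets:
  assumes n: "n \<ge> 1" and k: "k \<ge> 1"
  shows "of_nat (card (subset_chains (ballot_sets n) k)) =
    (\<Sum>d \<in> hilbert_tuples n k. rat_of_nat (multinomial n {1..k+1} d)
       * ((2 * of_nat (d (k + 1)) - of_nat n) / of_nat n))"
proof -
  let ?R = "{r. r \<le> n \<and> n - r \<ge> n - (n - 1) div 2}"
  have R: "?R = {..(n - 1) div 2}" using n by auto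
  have "card (subset_chains (ballot_sets n) k) = (\<Sum>A\<in>ballot_sets n. card (chains_with_top A k))"
    by (rule card_subset_chains_eq_sum) (use k ballot_sets_subset_closed in auto)
  also have "of_nat \<dots> = (\<Sum>A\<in>ballot_sets n. chain_weight k (card A))"
    unfolding of_nat_sum by (intro sum.cong refl card_chains_with_top k ballot_sets_finite)
  also have "\<dots> = (\<Sum>r\<in>?R. of_nat (ballot_count n r) * chain_weight k r)"
  proof -
    have "card A \<in> ?R" if "A \<in> ballot_sets n" for A
      unfolding R using ballot_card_less[OF that n] by auto
    then show ?thesis unfolding ballot_count_def by (intro sum_card_eq) auto
  qed
  also have "\<dots> = (\<Sum>r\<in>?R. of_nat (n choose r) * chain_weight k r
      * ((2 * of_nat (n - r) - of_nat n) / of_nat n))"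
  proof (intro sum.cong refl)
    fix r assume "r \<in> ?R"
    then have r: "r \<le> n" "2 * r \<le> n" unfolding R by auto
    then have "rat_of_nat (ballot_count n r) = of_nat (n choose r) * ((2 * of_nat (n - r) - of_nat n) / of_nat n)"
      using ballot_count_formula[OF n r(2)] n by (simp add: of_nat_diff field_simps)
    then show "of_nat (ballot_count n r) * chain_weight k r = of_nat (n choose r) * chain_weight k r
      * ((2 * of_nat (n - r) - of_nat n) / of_nat n)" by simp
  qed
  also have "\<dots> = (\<Sum>d \<in> hilbert_tuples n k. rat_of_nat (multinomial n {1..k+1} d)
       * ((2 * of_nat (d (k + 1)) - of_nat n) / of_nat n))"
    using sum_split_last_entry[where i = k and n = n and P = "\<lambda>x. x \<ge> n - (n - 1) div 2"
        and f = "\<lambda>x. (2 * of_nat x - of_nat n) / of_nat n"]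
    unfolding hilbert_tuples_def Suc_eq_plus1 by (rule sym)
  finally show ?thesis .
qed

text \<open>The k - 1 middle entries are at least 1 each, and together with the last entry they
  already exceed n.\<close>

lemma hilbert_tuples_eq_empty:
  assumes "k > (n - 1) div 2 + 1"
  shows "hilbert_tuples n k = {}"
proof (rule equals0I)
  fix d assume d: "d \<in> hilbert_tuples n k"
  have "{1..k + 1} = insert 1 (insert (k + 1) {2..k})" using assms by auto
  moreover have "(\<Sum>j = 1..k + 1. d j) = n" using d by (simp add: hilbert_tuples_def)
  ultimately have "n = d 1 + (d (k + 1) + (\<Sum>j = 2..k. d j))" using assms by simp
  moreover have "(\<Sum>j = 2..k. 1) \<le> (\<Sum>j = 2..k. d j)"
    using d by (intro sum_mono) (auto simp: hilbert_tuples_def)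
  moreover have "d (k + 1) \<ge> n - (n - 1) div 2" using d by (simp add: hilbert_tuples_def)
  ultimately show False using assms by simp
qed

section \<open>The graded pieces of the algebra\<close>

lemma keys_add_nat:
  "Poly_Mapping.keys (a + b :: nat \<Rightarrow>\<^sub>0 nat) = Poly_Mapping.keys a \<union> Poly_Mapping.keys b"
  by (auto simp: in_keys_iff lookup_add)

lemma keys_uminus_eq:
  "Poly_Mapping.keys (- p :: 'a \<Rightarrow>\<^sub>0 'b::ab_group_add) = Poly_Mapping.keys p"
  by (auto simp: in_keys_iff)

lemma mpoly_ring_simps:
  "\<zero>\<^bsub>mpoly_ring m\<^esub> = 0" "\<one>\<^bsub>mpoly_ring m\<^esub> = 1"
  "p \<oplus>\<^bsub>mpoly_ring m\<^esub> q = p + q" "p \<otimes>\<^bsub>mpoly_ring m\<^esub> q = p * q"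
  by (simp_all add: mpoly_ring_def)

lemma carrier_mpoly_ring:
  "p \<in> carrier (mpoly_ring m) \<longleftrightarrow> (\<forall>t \<in> Poly_Mapping.keys p. Poly_Mapping.keys t \<subseteq> {1..m})"
  by (simp add: mpoly_ring_def)

lemma carrier_mpoly_ring_add:
  "p \<in> carrier (mpoly_ring m) \<Longrightarrow> q \<in> carrier (mpoly_ring m) \<Longrightarrow> p + q \<in> carrier (mpoly_ring m)"
  using keys_add[of p q] unfolding carrier_mpoly_ring by blast

lemma carrier_mpoly_ring_uminus:
  "p \<in> carrier (mpoly_ring m) \<Longrightarrow> - p \<in> carrier (mpoly_ring m)"
  unfolding carrier_mpoly_ring keys_uminus_eq .

lemma carrier_mpoly_ring_mult:
  assumes "p \<in> carrier (mpoly_ring m)" "q \<in> carrier (mpoly_ring m)"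
  shows "p * q \<in> carrier (mpoly_ring m)"
  unfolding carrier_mpoly_ring
proof
  fix t assume "t \<in> Poly_Mapping.keys (p * q)"
  then obtain a b where "a \<in> Poly_Mapping.keys p" "b \<in> Poly_Mapping.keys q" "t = a + b"
    using keys_mult[of p q] by blast
  then show "Poly_Mapping.keys t \<subseteq> {1..m}"
    using assms unfolding carrier_mpoly_ring by (simp add: keys_add_nat)
qed

lemma carrier_mpoly_ring_single:
  "Poly_Mapping.keys t \<subseteq> {1..m} \<Longrightarrow> Poly_Mapping.single t c \<in> carrier (mpoly_ring m)"
  by (simp add: carrier_mpoly_ring)

lemma mpoly_ring_cring: "cring (mpoly_ring m :: 'k::field mpoly ring)"
proof (rule cringI)
  show "abelian_group (mpoly_ring m :: 'k mpoly ring)"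
  proof (rule abelian_groupI)
    fix p :: "'k mpoly" assume "p \<in> carrier (mpoly_ring m)"
    then show "\<exists>q\<in>carrier (mpoly_ring m). q \<oplus>\<^bsub>mpoly_ring m\<^esub> p = \<zero>\<^bsub>mpoly_ring m\<^esub>"
      by (intro bexI[of _ "- p"]) (simp_all add: mpoly_ring_simps carrier_mpoly_ring_uminus)
  qed (simp_all add: mpoly_ring_simps carrier_mpoly_ring_add add_ac, simp_all add: carrier_mpoly_ring)
  show "Group.comm_monoid (mpoly_ring m)"
    by (rule comm_monoidI)
      (simp_all add: mpoly_ring_simps carrier_mpoly_ring_mult mult_ac, simp_all add: carrier_mpoly_ring)
qed (simp add: mpoly_ring_simps distrib_right)

lemma mpoly_ring_a_inv:
  assumes "p \<in> carrier (mpoly_ring m)"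
  shows "\<ominus>\<^bsub>mpoly_ring m\<^esub> p = - p"
proof -
  interpret cring "mpoly_ring m" by (rule mpoly_ring_cring)
  show ?thesis using assms
    by (intro minus_equality) (simp_all add: mpoly_ring_simps carrier_mpoly_ring_uminus)
qed

section \<open>Standard monomials and the ideal\<close>

text \<open>These are the exponents of the standard monomials in x_1, ..., x_m, those divisible by
  no generator of the ideal.\<close>

definition chain_monomials :: "nat \<Rightarrow> (nat \<Rightarrow> nat set) \<Rightarrow> (nat \<Rightarrow>\<^sub>0 nat) set" where
  "chain_monomials m S = {t. Poly_Mapping.keys t \<subseteq> {1..m} \<and> (\<forall>i. Poly_Mapping.lookup t i \<le> 1) \<and>
     (\<forall>i \<in> Poly_Mapping.keys t. \<forall>j \<in> Poly_Mapping.keys t. S i \<subseteq> S j \<or> S j \<subseteq> S i)}"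

text \<open>The span of the nonstandard monomials, which turns out to be the ideal itself; phrased
  through keys so that membership can be read off the coefficients.\<close>

definition non_chain_polys :: "nat \<Rightarrow> (nat \<Rightarrow> nat set) \<Rightarrow> 'k::field mpoly set" where
  "non_chain_polys m S =
     {p \<in> carrier (mpoly_ring m). Poly_Mapping.keys p \<inter> chain_monomials m S = {}}"

text \<open>A factor has smaller exponents and smaller support than the product; consequently
  multiples of nonstandard monomials stay nonstandard.\<close>

lemma chain_monomials_addD:
  assumes "a + b \<in> chain_monomials m S"
  shows "b \<in> chain_monomials m S"
proof -
  have "Poly_Mapping.lookup b i \<le> 1" for i
    using assms by (auto simp: chain_monomials_def lookup_add dest: spec[of _ i])
  then show ?thesis using assms by (auto simp: chain_monomials_def keys_add_nat)
qed

lemma non_chain_polys_ideal: "ideal (non_chain_polys m S) (mpoly_ring m :: 'k::field mpoly ring)"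
proof -
  interpret cring "mpoly_ring m :: 'k mpoly ring" by (rule mpoly_ring_cring)
  have mult: "x * a \<in> non_chain_polys m S"
    if "a \<in> non_chain_polys m S" "x \<in> carrier (mpoly_ring m)" for a x :: "'k mpoly"
  proof -
    have "t \<notin> chain_monomials m S" if t: "t \<in> Poly_Mapping.keys (x * a)" for t
    proof -
      obtain u v where "v \<in> Poly_Mapping.keys a" "t = u + v"
        using t keys_mult[of x a] by blast
      then show ?thesis
        using \<open>a \<in> _\<close> chain_monomials_addD[of u v] by (auto simp: non_chain_polys_def)
    qed
    then show ?thesis using that carrier_mpoly_ring_mult by (auto simp: non_chain_polys_def)
  qed
  show ?thesis
  proof (rule idealI)
    show "subgroup (non_chain_polys m S) (add_monoid (mpoly_ring m :: 'k mpoly ring))"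
    proof (rule add.subgroupI)
      show "(non_chain_polys m S :: 'k mpoly set) \<noteq> {}"
        by (auto simp: non_chain_polys_def carrier_mpoly_ring intro!: exI[of _ 0])
      fix p :: "'k mpoly" assume p: "p \<in> non_chain_polys m S"
      then show "\<ominus>\<^bsub>mpoly_ring m\<^esub> p \<in> non_chain_polys m S"
        by (simp add: non_chain_polys_def mpoly_ring_a_inv carrier_mpoly_ring_uminus keys_uminus_eq)
      fix q :: "'k mpoly" assume q: "q \<in> non_chain_polys m S"
      show "p \<oplus>\<^bsub>mpoly_ring m\<^esub> q \<in> non_chain_polys m S"
        using p q keys_add[of p q]
        unfolding non_chain_polys_def mpoly_ring_simps by (auto intro: carrier_mpoly_ring_add)
    qed (auto simp: non_chain_polys_def)
  qed (use mult in \<open>simp_all add: ring_axioms mpoly_ring_simps mult.commute\<close>)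
qed

lemma poly_mapping_sum_single:
  "p = (\<Sum>t \<in> Poly_Mapping.keys p. Poly_Mapping.single t (Poly_Mapping.lookup p t))"
  by (rule poly_mapping_eqI) (simp add: lookup_sum lookup_single when_def in_keys_iff)

text \<open>The generators are nonstandard monomials, which gives one inclusion. Conversely every
  nonstandard monomial is a multiple of a generator, and a polynomial is the sum of its
  terms.\<close>

lemma poset_ideal_eq_non_chain_polys:
  "poset_ideal m S = (non_chain_polys m S :: 'k::field mpoly set)"
proof -
  let ?R = "mpoly_ring m :: 'k mpoly ring"
  let ?G = "{mvar i * mvar j | i j. i \<in> {1..m} \<and> j \<in> {1..m} \<and> \<not> S i \<subseteq> S j \<and> \<not> S j \<subseteq> S i}
      \<union> {(mvar i)\<^sup>2 | i. i \<in> {1..m}} :: 'k mpoly set"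
  interpret cring ?R by (rule mpoly_ring_cring)
  have mvar: "mvar i * mvar j = Poly_Mapping.single (Poly_Mapping.single i 1 + Poly_Mapping.single j 1) (1::'k)" for i j
    by (simp add: mvar_def mult_single)
  have sq: "Poly_Mapping.single i 1 + Poly_Mapping.single i 1 \<notin> chain_monomials m S" for i
  proof
    assume "Poly_Mapping.single i 1 + Poly_Mapping.single i 1 \<in> chain_monomials m S"
    then have "Poly_Mapping.lookup (Poly_Mapping.single i (1::nat) + Poly_Mapping.single i 1) i \<le> 1"
      unfolding chain_monomials_def by blast
    then show False by (simp add: lookup_add)
  qed
  have inc: "Poly_Mapping.single i 1 + Poly_Mapping.single j 1 \<notin> chain_monomials m S"
    if "\<not> S i \<subseteq> S j" "\<not> S j \<subseteq> S i" for i j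
    using that by (auto simp: chain_monomials_def keys_add_nat)
  have "mvar i * mvar j \<in> (non_chain_polys m S :: 'k mpoly set)"
    if "i \<in> {1..m}" "j \<in> {1..m}" "Poly_Mapping.single i 1 + Poly_Mapping.single j 1 \<notin> chain_monomials m S" for i j
    unfolding mvar using that by (simp add: non_chain_polys_def carrier_mpoly_ring keys_add_nat)
  then have sub: "?G \<subseteq> non_chain_polys m S"
    unfolding power2_eq_square using sq inc by blast
  then have carr: "?G \<subseteq> carrier ?R" by (auto simp: non_chain_polys_def)
  interpret J: ideal "genideal ?R ?G" ?R by (rule genideal_ideal[OF carr])
  have gen: "g \<in> genideal ?R ?G" if "g \<in> ?G" for g using genideal_self[OF carr] that by blast
  have mono: "Poly_Mapping.single t c \<in> genideal ?R ?G"
    if t: "Poly_Mapping.keys t \<subseteq> {1..m}" "t \<notin> chain_monomials m S" for t c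
  proof -
    \<comment> \<open>A repeated exponent yields the generator x_i^2, taken as i = j. Otherwise the
      monomial is squarefree with an incomparable pair in its support; i \<noteq> j then ensures
      that x_i x_j divides it.\<close>
    obtain i j where ij: "i \<in> {1..m}" "j \<in> {1..m}" "mvar i * mvar j \<in> ?G"
      "\<And>l. Poly_Mapping.lookup (Poly_Mapping.single i 1 + Poly_Mapping.single j (1::nat)) l \<le> Poly_Mapping.lookup t l"
    proof (cases "\<forall>i. Poly_Mapping.lookup t i \<le> 1")
      case True
      then obtain i j where ij: "i \<in> Poly_Mapping.keys t" "j \<in> Poly_Mapping.keys t"
        "\<not> S i \<subseteq> S j" "\<not> S j \<subseteq> S i" using t by (auto simp: chain_monomials_def)
      moreover have "i \<in> {1..m}" "j \<in> {1..m}" using ij t(1) by blast+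
      moreover have "i \<noteq> j" using ij by auto
      moreover have "Poly_Mapping.lookup (Poly_Mapping.single i 1 + Poly_Mapping.single j (1::nat)) l
          \<le> Poly_Mapping.lookup t l" for l
        using ij(1,2) \<open>i \<noteq> j\<close> by (auto simp: lookup_add lookup_single when_def in_keys_iff)
      ultimately show ?thesis by (intro that[of i j]) blast+
    next
      case False
      then obtain i where i: "Poly_Mapping.lookup t i > 1" by (auto simp: not_le)
      then have "i \<in> Poly_Mapping.keys t" by (simp add: in_keys_iff)
      then have "i \<in> {1..m}" using t(1) by blast
      moreover from this have "mvar i * mvar i \<in> ?G" unfolding power2_eq_square by blast
      moreover have "Poly_Mapping.lookup (Poly_Mapping.single i 1 + Poly_Mapping.single i (1::nat)) l
          \<le> Poly_Mapping.lookup t l" for l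
        using i by (auto simp: lookup_add lookup_single when_def)
      ultimately show ?thesis by (intro that[of i i])
    qed
    \<comment> \<open>Subtraction of exponents truncates at 0; by \<open>ij(4)\<close> it is exact
      here, so \<open>u\<close> is the exponent of the cofactor.\<close>
    define u where "u = t - (Poly_Mapping.single i 1 + Poly_Mapping.single j 1)"
    have tu: "t = u + (Poly_Mapping.single i 1 + Poly_Mapping.single j 1)"
      by (rule poly_mapping_eqI) (use ij(4) in \<open>simp add: u_def lookup_add lookup_minus\<close>)
    then have "Poly_Mapping.keys u \<subseteq> {1..m}" using t(1) by (simp add: keys_add_nat)
    then have "Poly_Mapping.single u c \<otimes>\<^bsub>?R\<^esub> (mvar i * mvar j) \<in> genideal ?R ?G"
      using gen[OF ij(3)] by (intro J.I_l_closed carrier_mpoly_ring_single)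
    then show ?thesis by (simp add: mpoly_ring_simps mvar mult_single tu)
  qed
  have "p \<in> genideal ?R ?G" if p: "p \<in> non_chain_polys m S" for p
  proof -
    have "(\<Sum>t \<in> T. Poly_Mapping.single t (Poly_Mapping.lookup p t)) \<in> genideal ?R ?G"
      if "T \<subseteq> Poly_Mapping.keys p" for T
      using finite_subset[OF that finite_keys] that
    proof (induction rule: finite_induct)
      case empty
      show ?case using J.zero_closed by (simp add: mpoly_ring_simps)
    next
      case (insert t T)
      have "Poly_Mapping.single t (Poly_Mapping.lookup p t) \<in> genideal ?R ?G"
        using p insert.prems by (intro mono) (auto simp: non_chain_polys_def carrier_mpoly_ring)
      then show ?case using insert J.a_closed by (simp add: mpoly_ring_simps)
    qed
    from this[OF order_refl] show ?thesis by (simp only: poly_mapping_sum_single[symmetric])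
  qed
  moreover have "genideal ?R ?G \<subseteq> non_chain_polys m S"
    by (rule genideal_minimal[OF non_chain_polys_ideal sub])
  ultimately show ?thesis unfolding poset_ideal_def by blast
qed

text \<open>The map \<open>mconst\<close> is an injective ring homomorphism. The image of this
  subfield in the quotient is the field over which dimensions are taken.\<close>

lemma mconst_subfield: "subfield (range mconst) (mpoly_ring m :: 'k::field mpoly ring)"
proof -
  let ?R = "mpoly_ring m :: 'k mpoly ring"
  interpret cring ?R by (rule mpoly_ring_cring)
  have c: "mconst c \<in> carrier ?R" for c by (simp add: mconst_def carrier_mpoly_ring)
  have ops: "mconst a * mconst b = mconst (a * b)" "mconst a + mconst b = mconst (a + b)"
    "- mconst a = mconst (- a)" "mconst 1 = 1" "mconst 0 = 0" for a b :: 'k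
    by (simp_all add: mconst_def mult_single single_add single_uminus)
  have eq: "mconst a = mconst b \<longleftrightarrow> a = b" for a b :: 'k
    unfolding mconst_def by (metis lookup_single_eq)
  show ?thesis
  proof (rule subfieldI)
    show "subcring (range mconst) ?R"
    proof (rule subcringI')
      show "subring (range mconst) ?R"
      proof (rule subringI)
        show "range mconst \<subseteq> carrier ?R" using c by auto
        show "\<one>\<^bsub>?R\<^esub> \<in> range mconst" unfolding mpoly_ring_simps ops(4)[symmetric] by simp
      qed (use c in \<open>auto simp: mpoly_ring_a_inv mpoly_ring_simps ops\<close>)
    qed
    show "Units (?R\<lparr>carrier := range mconst\<rparr>) = range mconst - {\<zero>\<^bsub>?R\<^esub>}"
    proof (intro equalityI subsetI)
      fix x assume "x \<in> Units (?R\<lparr>carrier := range mconst\<rparr>)"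
      then obtain a b where "x = mconst a" "mconst (a * b) = 1"
        by (auto simp: Units_def mpoly_ring_simps ops)
      then show "x \<in> range mconst - {\<zero>\<^bsub>?R\<^esub>}"
        using eq[of "a * b" 1] eq[of a 0] by (auto simp: mpoly_ring_simps ops)
    next
      fix x assume "x \<in> range mconst - {\<zero>\<^bsub>?R\<^esub>}"
      then obtain a where a: "x = mconst a" "x \<noteq> 0" by (auto simp: mpoly_ring_simps)
      then have "a \<noteq> 0" using ops(5) by blast
      then have "mconst a * mconst (inverse a) = 1" "mconst (inverse a) * mconst a = 1"
        by (simp_all add: ops)
      then show "x \<in> Units (?R\<lparr>carrier := range mconst\<rparr>)"
        using a by (auto simp: Units_def mpoly_ring_simps)
    qed
  qed
qed

section \<open>Monomial bases of the graded pieces\<close>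

definition chain_monomials_of_degree :: "nat \<Rightarrow> (nat \<Rightarrow> nat set) \<Rightarrow> nat \<Rightarrow> (nat \<Rightarrow>\<^sub>0 nat) set" where
  "chain_monomials_of_degree m S k =
     {t \<in> chain_monomials m S. (\<Sum>i \<in> Poly_Mapping.keys t. Poly_Mapping.lookup t i) = k}"

lemma chain_monomials_lookup:
  assumes "t \<in> chain_monomials m S"
  shows "Poly_Mapping.lookup t i = (if i \<in> Poly_Mapping.keys t then 1 else 0)"
proof -
  have "Poly_Mapping.lookup t i \<le> 1" using assms by (simp add: chain_monomials_def)
  then show ?thesis by (auto simp: in_keys_iff)
qed

text \<open>A squarefree monomial is determined by its support, whose size is the degree; the
  injective \<open>S\<close> carries supports to chains of the same size.\<close>

lemma bij_betw_chain_monomials_of_degree: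
  assumes bij: "bij_betw S {1..m} F"
  shows "bij_betw (\<lambda>t. S ` Poly_Mapping.keys t) (chain_monomials_of_degree m S k) (subset_chains F k)"
proof (rule bij_betwI')
  have inj: "inj_on S {1..m}" and img: "S ` {1..m} = F" using bij by (auto simp: bij_betw_def)
  have deg: "(\<Sum>i \<in> Poly_Mapping.keys t. Poly_Mapping.lookup t i) = card (S ` Poly_Mapping.keys t)"
    if "t \<in> chain_monomials m S" for t
  proof -
    have "Poly_Mapping.keys t \<subseteq> {1..m}" using that by (simp add: chain_monomials_def)
    then have "card (S ` Poly_Mapping.keys t) = card (Poly_Mapping.keys t)"
      using inj by (intro card_image) (rule inj_on_subset)
    then show ?thesis by (simp add: chain_monomials_lookup[OF that])
  qed
  show "S ` Poly_Mapping.keys t = S ` Poly_Mapping.keys u \<longleftrightarrow> t = u"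
    if t: "t \<in> chain_monomials_of_degree m S k" and u: "u \<in> chain_monomials_of_degree m S k" for t u
  proof
    assume "S ` Poly_Mapping.keys t = S ` Poly_Mapping.keys u"
    moreover have tu: "t \<in> chain_monomials m S" "u \<in> chain_monomials m S"
      using t u by (auto simp: chain_monomials_of_degree_def)
    moreover from tu have "Poly_Mapping.keys t \<subseteq> {1..m}" "Poly_Mapping.keys u \<subseteq> {1..m}"
      by (auto simp: chain_monomials_def)
    ultimately have "Poly_Mapping.keys t = Poly_Mapping.keys u"
      by (metis inj_on_image_eq_iff[OF inj])
    then show "t = u"
      by (intro poly_mapping_eqI) (simp add: chain_monomials_lookup[OF tu(1)] chain_monomials_lookup[OF tu(2)])
  qed simp
  show "S ` Poly_Mapping.keys t \<in> subset_chains F k" if "t \<in> chain_monomials_of_degree m S k" for t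
    using that deg[of t] img
    by (auto simp: chain_monomials_of_degree_def subset_chains_def chain_monomials_def)
  show "\<exists>t \<in> chain_monomials_of_degree m S k. C = S ` Poly_Mapping.keys t" if C: "C \<in> subset_chains F k" for C
  proof -
    define X where "X = {i \<in> {1..m}. S i \<in> C}"
    \<comment> \<open>The preimage of \<open>C\<close> is the squarefree monomial supported on the
      indices of its members.\<close>
    define t :: "nat \<Rightarrow>\<^sub>0 nat" where "t = (\<Sum>i\<in>X. Poly_Mapping.single i 1)"
    have "finite X" by (simp add: X_def)
    then have lt: "Poly_Mapping.lookup t i = (if i \<in> X then 1 else 0)" for i
      by (simp add: t_def lookup_sum lookup_single when_def)
    have kt: "Poly_Mapping.keys t = X" unfolding set_eq_iff in_keys_iff lt by simp
    have im: "S ` X = C" using C img by (auto simp: X_def subset_chains_def)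
    have "S i \<subseteq> S j \<or> S j \<subseteq> S i" if "i \<in> X" "j \<in> X" for i j
      using that C unfolding X_def subset_chains_def by blast
    moreover have "X \<subseteq> {1..m}" by (auto simp: X_def)
    ultimately have "t \<in> chain_monomials m S" by (simp add: chain_monomials_def kt lt)
    then have "t \<in> chain_monomials_of_degree m S k"
      using C deg[of t] by (simp add: chain_monomials_of_degree_def kt im subset_chains_def)
    then show ?thesis using im kt by blast
  qed
qed

lemma keys_minus_single_lookup:
  "Poly_Mapping.keys (p - Poly_Mapping.single t (Poly_Mapping.lookup p t)) = Poly_Mapping.keys p - {t}"
  for p :: "'a \<Rightarrow>\<^sub>0 'b::ab_group_add"
  by (auto simp: in_keys_iff lookup_minus lookup_single when_def split: if_splits)

text \<open>The classes of the standard monomials of degree k form a basis: all other terms vanish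
  in the quotient, and a combination of standard monomials lies in the ideal only if it is
  zero.\<close>

lemma dim_poset_algebra_piece:
  assumes fin: "finite (chain_monomials_of_degree m S k)"
  shows "(ring.dim (poset_algebra m S :: 'k::field mpoly set ring) over poset_algebra_scalars m S)
    (poset_algebra_piece m S k) = card (chain_monomials_of_degree m S k)"
proof -
  let ?R = "mpoly_ring m :: 'k mpoly ring" and ?Q = "poset_algebra m S :: 'k mpoly set ring"
  let ?J = "poset_ideal m S :: 'k mpoly set" and ?K = "poset_algebra_scalars m S :: 'k mpoly set set"
  define h where "h = (\<lambda>p. ?J +>\<^bsub>?R\<^esub> p)"
  interpret R: cring ?R by (rule mpoly_ring_cring)
  interpret J: ideal ?J ?R
    unfolding poset_ideal_eq_non_chain_polys by (rule non_chain_polys_ideal)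
  interpret h: ring_hom_ring ?R ?Q h
    unfolding h_def poset_algebra_def by (rule J.rcos_ring_hom_ring)
  have h_eq: "h p = h q \<longleftrightarrow> Poly_Mapping.keys (p - q) \<inter> chain_monomials m S = {}"
    if "p \<in> carrier ?R" "q \<in> carrier ?R" for p q
  proof -
    have "p \<ominus>\<^bsub>?R\<^esub> q = p - q"
      using that by (simp add: a_minus_def mpoly_ring_a_inv mpoly_ring_simps)
    moreover from this have "p - q \<in> carrier ?R" using that R.minus_closed by metis
    moreover have "h p = h q \<longleftrightarrow> p \<ominus>\<^bsub>?R\<^esub> q \<in> ?J"
      unfolding h_def using R.quotient_eq_iff_same_a_r_cos[OF J.is_ideal that] by (rule sym)
    ultimately show ?thesis
      unfolding poset_ideal_eq_non_chain_polys non_chain_polys_def by simp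
  qed
  have K_eq: "?K = h ` range mconst" by (auto simp: poset_algebra_scalars_def h_def)
  have zero_chain: "0 \<in> chain_monomials m S" by (simp add: chain_monomials_def)
  have one0: "1 \<in> carrier ?R" "0 \<in> carrier ?R"
    using R.one_closed R.zero_closed by (simp_all add: mpoly_ring_simps)
  \<comment> \<open>The monomial 1 is standard, so the quotient is nontrivial; this lets the
    subfield of constants pass to the quotient.\<close>
  have "h 1 \<noteq> h 0" unfolding h_eq[OF one0] using zero_chain by simp
  then have "\<one>\<^bsub>?Q\<^esub> \<noteq> \<zero>\<^bsub>?Q\<^esub>" using h.hom_one h.hom_zero by (simp add: mpoly_ring_simps)
  then have K: "subfield ?K ?Q" unfolding K_eq by (intro h.img_is_subfield(2) mconst_subfield)
  \<comment> \<open>Independence and span are proved together, because independence of a new element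
    is tested against the span of the previous ones. Describing the span by supports turns this test
    into one on coefficients.\<close>
  have basis: "h.S.independent ?K (map (\<lambda>t. h (Poly_Mapping.single t 1)) ts) \<and>
      h.S.Span ?K (map (\<lambda>t. h (Poly_Mapping.single t 1)) ts) = h ` {p. Poly_Mapping.keys p \<subseteq> set ts}"
    if "distinct ts" "set ts \<subseteq> chain_monomials m S" for ts
    using that
  proof (induction ts)
    case Nil
    have "{p :: 'k mpoly. Poly_Mapping.keys p \<subseteq> {}} = {0}"
      by auto
    then show ?case using h.hom_zero by (simp add: mpoly_ring_simps)
  next
    case (Cons t ts)
    let ?mono = "\<lambda>t. h (Poly_Mapping.single t 1)"
    have carr: "p \<in> carrier ?R" if "Poly_Mapping.keys p \<subseteq> set (t # ts)" for p :: "'k mpoly"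
      unfolding carrier_mpoly_ring
    proof
      fix u assume "u \<in> Poly_Mapping.keys p"
      then have "u \<in> chain_monomials m S" using that Cons.prems(2) by blast
      then show "Poly_Mapping.keys u \<subseteq> {1..m}" by (simp add: chain_monomials_def)
    qed
    have carr1: "Poly_Mapping.single t c \<in> carrier ?R" for c by (rule carr) simp
    have carrc: "mconst c \<in> carrier ?R" for c by (simp add: mconst_def carrier_mpoly_ring)
    have IH: "h.S.independent ?K (map ?mono ts)" "h.S.Span ?K (map ?mono ts) = h ` {p. Poly_Mapping.keys p \<subseteq> set ts}"
      using Cons by auto
    have lin: "h (mconst c) \<otimes>\<^bsub>?Q\<^esub> ?mono t \<oplus>\<^bsub>?Q\<^esub> h p = h (Poly_Mapping.single t c + p)"
      if "Poly_Mapping.keys p \<subseteq> set ts" for c p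
    proof -
      have "p \<in> carrier ?R" using that by (intro carr) auto
      then have "h (mconst c \<otimes>\<^bsub>?R\<^esub> Poly_Mapping.single t 1 \<oplus>\<^bsub>?R\<^esub> p)
          = h (mconst c) \<otimes>\<^bsub>?Q\<^esub> ?mono t \<oplus>\<^bsub>?Q\<^esub> h p"
        using carr1 carrc by simp
      then show ?thesis by (simp add: mpoly_ring_simps mconst_def mult_single)
    qed
    \<comment> \<open>Otherwise x^t would differ from a combination of the monomials in
      \<open>ts\<close> by an element of the ideal, although the difference has coefficient 1 at the
      standard monomial t.\<close>
    have "?mono t \<notin> h.S.Span ?K (map ?mono ts)"
    proof
      assume "?mono t \<in> h.S.Span ?K (map ?mono ts)"
      then obtain p where p: "Poly_Mapping.keys p \<subseteq> set ts" "?mono t = h p" using IH(2) by auto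
      have "p \<in> carrier ?R" using p(1) by (intro carr) auto
      then have "Poly_Mapping.keys (Poly_Mapping.single t 1 - p) \<inter> chain_monomials m S = {}"
        using p(2) h_eq carr1 by simp
      then have "t \<notin> Poly_Mapping.keys (Poly_Mapping.single t 1 - p)" using Cons.prems by auto
      moreover have "t \<notin> Poly_Mapping.keys p" using p(1) Cons.prems by auto
      ultimately show False by (simp add: in_keys_iff lookup_minus)
    qed
    then have "h.S.independent ?K (map ?mono (t # ts))"
      using IH(1) carr1 by (auto intro!: h.S.independent.intros(2))
    moreover have "h.S.Span ?K (map ?mono (t # ts)) = h ` {p. Poly_Mapping.keys p \<subseteq> set (t # ts)}"
    proof -
      have "h.S.Span ?K (map ?mono (t # ts)) = h.S.line_extension ?K (?mono t) (h ` {p. Poly_Mapping.keys p \<subseteq> set ts})"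
        using IH(2) by simp
      also have "\<dots> = h ` {p. Poly_Mapping.keys p \<subseteq> set (t # ts)}"
      proof (intro equalityI subsetI)
        fix x assume "x \<in> h.S.line_extension ?K (?mono t) (h ` {p. Poly_Mapping.keys p \<subseteq> set ts})"
        then obtain c p where p: "Poly_Mapping.keys p \<subseteq> set ts" "x = h (Poly_Mapping.single t c + p)"
          unfolding h.S.line_extension_mem_iff K_eq using lin by auto
        then have "Poly_Mapping.keys (Poly_Mapping.single t c + p) \<subseteq> set (t # ts)"
          using keys_add[of "Poly_Mapping.single t c" p] by (auto split: if_splits)
        then show "x \<in> h ` {p. Poly_Mapping.keys p \<subseteq> set (t # ts)}" using p(2) by blast
      next
        fix x assume "x \<in> h ` {p. Poly_Mapping.keys p \<subseteq> set (t # ts)}"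
        then obtain p where p: "Poly_Mapping.keys p \<subseteq> set (t # ts)" "x = h p" by auto
        \<comment> \<open>Removing the t-term leaves a polynomial supported on \<open>ts\<close>,
          which exhibits x as a point of the line extension.\<close>
        define q where "q = p - Poly_Mapping.single t (Poly_Mapping.lookup p t)"
        have q: "Poly_Mapping.keys q \<subseteq> set ts" using p(1) by (auto simp: q_def keys_minus_single_lookup)
        then have "x = h (mconst (Poly_Mapping.lookup p t)) \<otimes>\<^bsub>?Q\<^esub> ?mono t \<oplus>\<^bsub>?Q\<^esub> h q"
          unfolding lin[OF q] p(2) by (simp add: q_def)
        then show "x \<in> h.S.line_extension ?K (?mono t) (h ` {p. Poly_Mapping.keys p \<subseteq> set ts})"
          unfolding h.S.line_extension_mem_iff K_eq using q by blast
      qed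
      finally show ?thesis .
    qed
    ultimately show ?case by blast
  qed
  obtain ts where ts: "set ts = chain_monomials_of_degree m S k" "distinct ts"
    using finite_distinct_list[OF fin] by blast
  have sub: "set ts \<subseteq> chain_monomials m S" by (auto simp: ts(1) chain_monomials_of_degree_def)
  have "poset_algebra_piece m S k = h ` {p \<in> carrier ?R. homogeneous k p}"
    by (simp add: poset_algebra_piece_def h_def)
  also have "\<dots> = h ` {p. Poly_Mapping.keys p \<subseteq> set ts}"
  proof (intro equalityI subsetI)
    fix x assume "x \<in> h ` {p \<in> carrier ?R. homogeneous k p}"
    then obtain p where p: "p \<in> carrier ?R" "homogeneous k p" "x = h p" by auto
    \<comment> \<open>\<open>q\<close> keeps only the standard terms of \<open>p\<close>; the
      discarded ones lie in the ideal, so the class is unchanged.\<close>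
    define q where "q = (\<Sum>t \<in> Poly_Mapping.keys p \<inter> chain_monomials m S.
      Poly_Mapping.single t (Poly_Mapping.lookup p t))"
    have lq: "Poly_Mapping.lookup q t = (if t \<in> chain_monomials m S then Poly_Mapping.lookup p t else 0)" for t
      by (simp add: q_def lookup_sum lookup_single when_def in_keys_iff)
    have kq: "Poly_Mapping.keys q = Poly_Mapping.keys p \<inter> chain_monomials m S"
      by (auto simp: in_keys_iff lq split: if_splits)
    have "q \<in> carrier ?R" using p(1) by (auto simp: carrier_mpoly_ring kq)
    then have "h p = h q" using p(1) by (subst h_eq) (auto simp: in_keys_iff lookup_minus lq)
    moreover have "Poly_Mapping.keys q \<subseteq> set ts"
      using p(2) by (auto simp: kq ts(1) chain_monomials_of_degree_def homogeneous_def)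
    ultimately show "x \<in> h ` {p. Poly_Mapping.keys p \<subseteq> set ts}" using p(3) by blast
  next
    fix x assume "x \<in> h ` {p. Poly_Mapping.keys p \<subseteq> set ts}"
    then obtain p where p: "Poly_Mapping.keys p \<subseteq> set ts" "x = h p" by auto
    have "p \<in> carrier ?R" "homogeneous k p"
      using p(1) unfolding carrier_mpoly_ring homogeneous_def ts(1)
      by (auto simp: chain_monomials_of_degree_def chain_monomials_def)
    then show "x \<in> h ` {p \<in> carrier ?R. homogeneous k p}" using p(2) by blast
  qed
  finally have "h.S.dimension (length ts) ?K (poset_algebra_piece m S k)"
    using h.S.dimension_independent[of ?K "map (\<lambda>t. h (Poly_Mapping.single t 1)) ts"] basis[OF ts(2) sub] by simp
  then show ?thesis
    using h.S.dimI[OF K] ts distinct_card[OF ts(2)] by metis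
qed

section \<open>The Hilbert series\<close>

theorem theorem4p3:
  fixes n m :: nat and S :: "nat \<Rightarrow> nat set"
  assumes "n \<ge> 3"
    and "m = card (CP_poset n)"
    and "bij_betw S {1..m} (CP_poset n)"
  shows "hilbert_series (poset_algebra m S :: 'k::field mpoly set ring)
           (poset_algebra_scalars m S) (poset_algebra_piece m S)
         = 1 + (\<Sum>i = 1..(n - 1) div 2 + 1.
                  fps_const (\<Sum>d \<in> hilbert_tuples n i.
                    of_nat (multinomial n {1..i+1} d)
                      * ((2 * of_nat (d (i + 1)) - of_nat n) / of_nat n))
                  * fps_X ^ i)"
proof (rule fps_ext)
  fix k
  let ?w = "\<lambda>i. \<Sum>d \<in> hilbert_tuples n i. rat_of_nat (multinomial n {1..i+1} d)
                      * ((2 * of_nat (d (i + 1)) - of_nat n) / of_nat n)"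
  have n: "n \<ge> 1" using assms(1) by simp
  have bij: "bij_betw S {1..m} (ballot_sets n)"
    using assms(3) CP_poset_eq_ballot_sets[OF n] by simp
  note b = bij_betw_chain_monomials_of_degree[OF bij, of k]
  have "finite (chain_monomials_of_degree m S k)"
    using bij_betw_finite[OF b] finite_subset_chains[OF finite_ballot_sets] by blast
  then have "(ring.dim (poset_algebra m S :: 'k mpoly set ring) over poset_algebra_scalars m S)
      (poset_algebra_piece m S k) = card (subset_chains (ballot_sets n) k)"
    using dim_poset_algebra_piece bij_betw_same_card[OF b] by metis
  then have lhs: "fps_nth (hilbert_series (poset_algebra m S :: 'k mpoly set ring)
      (poset_algebra_scalars m S) (poset_algebra_piece m S)) k
      = of_nat (card (subset_chains (ballot_sets n) k))"
    by (simp add: hilbert_series_def)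
  have rhs: "fps_nth (1 + (\<Sum>i = 1..(n - 1) div 2 + 1. fps_const (?w i) * fps_X ^ i)) k
      = (if k = 0 then 1 else 0) + (if k \<in> {1..(n - 1) div 2 + 1} then ?w k else 0)"
    by (simp add: fps_sum_nth fps_X_power_iff if_distrib[of "\<lambda>x. _ * x"] sum.delta' cong: if_cong)
  have "rat_of_nat (card (subset_chains (ballot_sets n) k))
      = (if k = 0 then 1 else 0) + (if k \<in> {1..(n - 1) div 2 + 1} then ?w k else 0)"
  proof (cases "k = 0")
    case True
    \<comment> \<open>\<open>card\<close> is also 0 on infinite sets; finiteness leaves the empty
      chain as the only one of size 0.\<close>
    have "finite C" if "C \<subseteq> ballot_sets n" for C using that finite_subset finite_ballot_sets by blast
    then have "subset_chains (ballot_sets n) 0 = {{}}"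
      by (auto simp: subset_chains_def)
    then show ?thesis using True by simp
  next
    case False
    \<comment> \<open>The closed form holds for every positive k; above the summation range its
      index set of tuples is empty.\<close>
    then show ?thesis
      using card_subset_chains_ballot_sets[OF n, of k] hilbert_tuples_eq_empty[of n k] by auto
  qed
  then show "fps_nth (hilbert_series (poset_algebra m S :: 'k mpoly set ring)
      (poset_algebra_scalars m S) (poset_algebra_piece m S)) k
    = fps_nth (1 + (\<Sum>i = 1..(n - 1) div 2 + 1. fps_const (?w i) * fps_X ^ i)) k"
    unfolding lhs rhs .
qed

end
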